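(* Let $\mathcal{H}$ be a complex separable Hilbert space, let $A,B$ be bounded linear operators on $\mathcal{H}$, and put $\mathcal{M}=\operatorname{ran}A$, $\mathcal{N}=\operatorname{ran}B$. Let $\Gamma=(AA^*+BB^* )^{1/2}$ and let $C_A,C_B$ be the unique contractions on $\mathcal{H}$ with $A=\Gamma C_A$, $B=\Gamma C_B$ and $\operatorname{ran}C_A,\operatorname{ran}C_B\subseteq\overline{\operatorname{ran}}\,\Gamma$. Then $$P_{\mathcal{M},\mathcal{N}}=\Gamma C_AC_A^*\Gamma^{-1}\ \hat{\dotplus}\ (\{0\}\times(\mathcal{M}\cap\mathcal{N})),$$ where $\Gamma C_AC_A^*\Gamma^{-1}$ is an operator part of $P_{\mathcal{M},\mathcal{N}}$.
   Context: A linear relation on $\mathcal{H}$ is a linear subspace of $\mathcal{H}\times\mathcal{H}$; operators are identified with their graphs. For a relation $T$: $\operatorname{dom}T$, $\operatorname{ran}T$ are the sets of first, resp. second, components, and $\operatorname{mul}T=\{y:(0,y)\in T\}$; $T$ is an operator iff $\operatorname{mul}T=\{0\}$. $T^{-1}=\{(y,x):(x,y)\in T\}$ (so $\Gamma^{-1}=\{(\Gamma x,x):x\in\mathcal{H}\}$ is a relation), and $RT=\{(x,y):(x,z)\in T,(z,y)\in R\text{ for some }z\}$. $T\,\hat{+}\,S$ is the sum of $T$ and $S$ as subspaces of $\mathcal{H}\times\mathcal{H}$, written $T\,\hat{\dotplus}\,S$ when $T\cap S=\{0\}$. For subspaces $\mathcal{M},\mathcal{N}$ of $\mathcal{H}$,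 $P_{\mathcal{M},\mathcal{N}}=\{(m+n,m):m\in\mathcal{M},n\in\mathcal{N}\}$, the multivalued projection with range $\mathcal{M}$, kernel $\mathcal{N}$, domain $\mathcal{M}+\mathcal{N}$ and multivalued part $\mathcal{M}\cap\mathcal{N}$. An operator part of a relation $T$ is an operator $\tilde T\subseteq T$ with $\operatorname{dom}\tilde T=\operatorname{dom}T$. *)

theory Defs
  imports "HOL-Analysis.Analysis"
begin

text \<open>
  Complex inner product spaces, linear in the first argument. The class extends \<open>real_inner\<close>
  so that norm and topology are the library's; \<open>inner_eq_Re_cinner\<close> forces
  \<open>norm x = sqrt (Re (cinner x x))\<close>, and positive definiteness of \<open>cinner\<close> is inherited from
  \<open>inner\<close>, since \<open>cinner x x\<close> is real by conjugate symmetry.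
\<close>

class complex_inner_space = real_inner +
  fixes scaleC :: "complex \<Rightarrow> 'a \<Rightarrow> 'a" (infixr "*\<^sub>C" 75)
    and cinner :: "'a \<Rightarrow> 'a \<Rightarrow> complex"
  assumes scaleC_add_right: "c *\<^sub>C (x + y) = c *\<^sub>C x + c *\<^sub>C y"
    and scaleC_add_left: "(c + d) *\<^sub>C x = c *\<^sub>C x + d *\<^sub>C x"
    and scaleC_scaleC: "c *\<^sub>C d *\<^sub>C x = (c * d) *\<^sub>C x"
    and scaleC_of_real: "of_real r *\<^sub>C x = r *\<^sub>R x"
    and cinner_commute: "cinner x y = cnj (cinner y x)"
    and cinner_add_left: "cinner (x + y) z = cinner x z + cinner y z"
    and cinner_scaleC_left: "cinner (c *\<^sub>C x) y = c * cinner x y"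
    and inner_eq_Re_cinner: "inner x y = Re (cinner x y)"

class complex_hilbert_space = complex_inner_space + complete_space

instantiation complex :: complex_hilbert_space
begin

definition scaleC_complex :: "complex \<Rightarrow> complex \<Rightarrow> complex" where
  "scaleC_complex c x = c * x"

definition cinner_complex :: "complex \<Rightarrow> complex \<Rightarrow> complex" where
  "cinner_complex x y = x * cnj y"

instance
  by standard
    (auto simp: scaleC_complex_def cinner_complex_def algebra_simps scaleR_conv_of_real inner_complex_def)

end

definition bounded_clinear :: "('a::complex_inner_space \<Rightarrow> 'b::complex_inner_space) \<Rightarrow> bool" where
  "bounded_clinear f \<longleftrightarrow> bounded_linear f \<and> (\<forall>c x. f (c *\<^sub>C x) = c *\<^sub>C f x)"

text \<open>On a Hilbert space, the adjoint of a bounded operator is the unique function below.\<close>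

definition cadjoint :: "('a::complex_hilbert_space \<Rightarrow> 'a) \<Rightarrow> 'a \<Rightarrow> 'a" where
  "cadjoint T = (THE S. \<forall>x y. cinner (T x) y = cinner x (S y))"

definition positive_operator :: "('a::complex_hilbert_space \<Rightarrow> 'a) \<Rightarrow> bool" where
  "positive_operator T \<longleftrightarrow>
    bounded_clinear T \<and> (\<forall>x. cinner (T x) x \<in> \<real> \<and> 0 \<le> Re (cinner (T x) x))"

text \<open>\<open>is_operator_sqrt S T\<close> says that \<open>S\<close> is the (unique) positive square root of \<open>T\<close>.\<close>

definition is_operator_sqrt ::
    "('a::complex_hilbert_space \<Rightarrow> 'a) \<Rightarrow> ('a \<Rightarrow> 'a) \<Rightarrow> bool" where
  "is_operator_sqrt S T \<longleftrightarrow> positive_operator S \<and> S \<circ> S = T"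

definition contraction :: "('a::complex_inner_space \<Rightarrow> 'b::complex_inner_space) \<Rightarrow> bool" where
  "contraction f \<longleftrightarrow> bounded_clinear f \<and> (\<forall>x. norm (f x) \<le> norm x)"

definition linear_relation :: "('a::complex_inner_space \<times> 'a) set \<Rightarrow> bool" where
  "linear_relation T \<longleftrightarrow>
    subspace T \<and> (\<forall>c x y. (x, y) \<in> T \<longrightarrow> (c *\<^sub>C x, c *\<^sub>C y) \<in> T)"

definition op_graph :: "('a \<Rightarrow> 'a) \<Rightarrow> ('a \<times> 'a) set" where
  "op_graph f = {(x, f x) |x. True}"

definition rel_mul :: "('a::complex_inner_space \<times> 'a) set \<Rightarrow> 'a set" where
  "rel_mul T = {y. (0, y) \<in> T}"

definition is_operator :: "('a::complex_inner_space \<times> 'a) set \<Rightarrow> bool" where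
  "is_operator T \<longleftrightarrow> linear_relation T \<and> rel_mul T = {0}"

text \<open>The product \<open>R \<odot> T\<close> applies \<open>T\<close> first, whereas \<open>O\<close> composes from left to right.\<close>

definition rel_prod :: "('a \<times> 'a) set \<Rightarrow> ('a \<times> 'a) set \<Rightarrow> ('a \<times> 'a) set" (infixr "\<odot>" 75) where
  "R \<odot> T = T O R"

text \<open>
  \<open>is_direct_sum R T S\<close> says that \<open>R\<close> is the direct sum of \<open>T\<close> and \<open>S\<close> as subspaces of the
  product space; \<open>T + S\<close> is the elementwise sum of sets of pairs.
\<close>

definition is_direct_sum ::
    "('a::complex_inner_space \<times> 'a) set \<Rightarrow> ('a \<times> 'a) set \<Rightarrow> ('a \<times> 'a) set \<Rightarrow> bool" where
  "is_direct_sum R T S \<longleftrightarrow>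
    linear_relation T \<and> linear_relation S \<and> R = T + S \<and> T \<inter> S = {0}"

definition mv_projection :: "'a::complex_inner_space set \<Rightarrow> 'a set \<Rightarrow> ('a \<times> 'a) set" where
  "mv_projection M N = {(m + n, m) |m n. m \<in> M \<and> n \<in> N}"

definition is_operator_part ::
    "('a::complex_inner_space \<times> 'a) set \<Rightarrow> ('a \<times> 'a) set \<Rightarrow> bool" where
  "is_operator_part S T \<longleftrightarrow> is_operator S \<and> S \<subseteq> T \<and> Domain S = Domain T"

end

theory Submission
  imports Defs
begin

text \<open>
  Put \<open>Q = C\<^sub>A C\<^sub>A\<^sup>* + C\<^sub>B C\<^sub>B\<^sup>*\<close>. Since \<open>\<Gamma>\<close> is self-adjoint, \<open>\<Gamma>\<^sup>2 = \<Gamma> Q \<Gamma>\<close>, so \<open>Q \<Gamma> z - \<Gamma> z\<close> lies in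
  \<open>ker \<Gamma>\<close> as well as in the closure of \<open>ran \<Gamma>\<close>, its orthogonal complement; hence \<open>Q \<Gamma> = \<Gamma>\<close>, and
  taking adjoints, \<open>\<Gamma> Q = \<Gamma>\<close>. Thus \<open>\<Gamma> x = A (C\<^sub>A\<^sup>* x) + B (C\<^sub>B\<^sup>* x)\<close>, which shows that \<open>T\<close> is contained in
  the projection and that both have the domain \<open>ran \<Gamma>\<close>. It is an operator because
  \<open>ker \<Gamma> \<subseteq> ker C\<^sub>A\<^sup>*\<close>, by the range condition on \<open>C\<^sub>A\<close>.
\<close>

text \<open>The representing vector minimises \<open>J x = \<parallel>x\<parallel>\<^sup>2 - 2 f x\<close>; the parallelogram law makes every
  minimising sequence Cauchy.\<close>

lemma riesz_representation:
  fixes f :: "'a::{real_inner,complete_space} \<Rightarrow> real"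
  assumes f: "bounded_linear f"
  shows "\<exists>a. \<forall>x. f x = x \<bullet> a"
proof -
  interpret f: bounded_linear f by fact
  define J where "J x = x \<bullet> x - 2 * f x" for x
  obtain K where K: "\<And>x. norm (f x) \<le> norm x * K"
    using f.bounded by blast
  \<comment> \<open>Since f x is at most K times the norm of x, completing the square in the norm
    bounds \<open>J\<close> from below.\<close>
  have "- K\<^sup>2 \<le> J x" for x
  proof -
    have "f x \<le> norm x * K" using K[of x] by simp
    moreover have "0 \<le> (norm x - K)\<^sup>2" by simp
    ultimately show ?thesis
      by (simp add: J_def power2_eq_square algebra_simps flip: power2_norm_eq_inner)
  qed
  then have bdd: "bdd_below (range J)" by (intro bdd_belowI[of _ "- K\<^sup>2"]) auto
  define m where "m = Inf (range J)"
  have m_le: "m \<le> J x" for x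
    unfolding m_def using bdd by (simp add: cINF_lower)
  \<comment> \<open>At the midpoint the linear parts of \<open>J\<close> cancel because
    \<open>f\<close> is additive, so only the parallelogram identity for the squared norms
    remains.\<close>
  have parallelogram: "(norm (x - y))\<^sup>2 \<le> 2 * (J x + J y - 2 * m)" for x y
  proof -
    have "(norm (x - y))\<^sup>2 = 2 * (J x + J y - 2 * J ((1/2) *\<^sub>R (x + y)))"
      by (simp add: J_def power2_norm_eq_inner f.add f.scaleR algebra_simps inner_commute)
    then show ?thesis using m_le[of "(1/2) *\<^sub>R (x + y)"] by simp
  qed
  have "\<exists>x. J x < m + 1 / real (Suc n)" for n
    using cINF_less_iff[of UNIV J "m + 1 / real (Suc n)"] bdd by (simp add: m_def)
  then obtain X where X: "\<And>n. J (X n) < m + 1 / real (Suc n)" by metis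
  have "Cauchy X"
  proof (rule metric_CauchyI)
    fix e :: real assume "0 < e"
    \<comment> \<open>Two values of \<open>J\<close> within \<open>e\<^sup>2 / 4\<close> of
      \<open>m\<close> make the parallelogram bound equal to at most
      \<open>e\<^sup>2\<close>.\<close>
    then obtain k where k: "1 / real (Suc k) < e\<^sup>2 / 4"
      using reals_Archimedean[of "e\<^sup>2 / 4"] by (auto simp: inverse_eq_divide)
    have JX: "J (X n) < m + e\<^sup>2 / 4" if "k \<le> n" for n
    proof -
      have "1 / real (Suc n) \<le> 1 / real (Suc k)" using that by (intro divide_left_mono) auto
      then show ?thesis using X[of n] k by linarith
    qed
    have "dist (X i) (X j) < e" if "k \<le> i" "k \<le> j" for i j
    proof -
      have "(norm (X i - X j))\<^sup>2 < e\<^sup>2"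
        using parallelogram[of "X i" "X j"] JX[OF that(1)] JX[OF that(2)] by argo
      then show ?thesis
        using \<open>0 < e\<close> by (simp add: dist_norm power_less_imp_less_base)
    qed
    then show "\<exists>M. \<forall>i\<ge>M. \<forall>j\<ge>M. dist (X i) (X j) < e" by blast
  qed
  then obtain a where a: "X \<longlonglongrightarrow> a"
    using Cauchy_convergent convergent_def by blast
  have "(\<lambda>n. J (X n)) \<longlonglongrightarrow> J a"
    unfolding J_def by (intro tendsto_intros a f.tendsto)
  moreover have "(\<lambda>n. m + 1 / real (Suc n)) \<longlonglongrightarrow> m + 0"
    by (intro tendsto_intros LIMSEQ_inverse_real_of_nat[unfolded inverse_eq_divide])
  ultimately have Ja: "J a \<le> m"
    using X by (intro LIMSEQ_le[of "\<lambda>n. J (X n)" "J a" "\<lambda>n. m + 1 / real (Suc n)" m])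
      (auto intro!: less_imp_le simp del: of_nat_Suc)
  have "f x = x \<bullet> a" for x
  proof (cases "x = 0")
    case False
    \<comment> \<open>On the line through \<open>a\<close> in direction \<open>x\<close>,
      \<open>J\<close> is a quadratic with slope \<open>2 * c\<close> at 0, and \<open>t\<close> is
      its minimiser. It falls there by \<open>c\<^sup>2 / (x \<bullet> x)\<close>, so minimality of
      \<open>a\<close> forces \<open>c = 0\<close>.\<close>
    define c where "c = x \<bullet> a - f x"
    define t where "t = - c / (x \<bullet> x)"
    have xx: "x \<bullet> x > 0" using False by simp
    have "J (a + t *\<^sub>R x) = J a + 2 * t * c + t * t * (x \<bullet> x)"
      by (simp add: J_def c_def f.add f.scaleR algebra_simps inner_commute)
    moreover have "2 * t * c + t * t * (x \<bullet> x) = - (c\<^sup>2 / (x \<bullet> x))"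
      using xx by (simp add: t_def field_simps power2_eq_square)
    ultimately have "c\<^sup>2 / (x \<bullet> x) \<le> 0"
      using m_le[of "a + t *\<^sub>R x"] Ja by linarith
    then have "c = 0" using xx by (simp add: divide_le_0_iff)
    then show ?thesis by (simp add: c_def)
  qed (simp add: f.zero)
  then show ?thesis by blast
qed

section \<open>Adjoints and positive operators\<close>

lemma cinner_scaleC_right: "cinner x (c *\<^sub>C y) = cnj c * cinner x y"
  by (subst cinner_commute) (simp add: cinner_scaleC_left flip: cinner_commute)

lemma cinner_add_right: "cinner x (y + z) = cinner x y + cinner x z"
  by (subst cinner_commute) (simp add: cinner_add_left flip: cinner_commute)

text \<open>Lets identities for the real inner product be lifted to the complex one.\<close>

lemma Im_cinner: "Im (cinner x y) = - ((\<i> *\<^sub>C x) \<bullet> y)"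
  by (simp add: inner_eq_Re_cinner cinner_scaleC_left)

lemma cinner_right_eqI:
  assumes "\<And>z. cinner z x = cinner z y"
  shows "x = y"
  using assms by (intro vector_eq_ldot[THEN iffD1]) (simp add: inner_eq_Re_cinner)

lemma cadjoint_unique:
  assumes "\<And>x y. cinner (T x) y = cinner x (S y)"
  shows "cadjoint T = S"
  unfolding cadjoint_def
proof (rule the_equality)
  fix S' assume "\<forall>x y. cinner (T x) y = cinner x (S' y)"
  then have "cinner z (S' y) = cinner z (S y)" for y z
    using assms[of z y] by simp
  then show "S' = S"
    by (blast intro: cinner_right_eqI)
qed (use assms in blast)

text \<open>Existence behind the \<open>THE\<close> of \<open>cadjoint\<close>: real Riesz
  representation gives \<open>S\<close> with the right real parts, and commuting \<open>T\<close>
  with multiplication by \<open>\<i>\<close> carries this over to the imaginary parts.\<close>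

lemma cinner_cadjoint:
  assumes T: "bounded_clinear T"
  shows "cinner (T x) y = cinner x (cadjoint T y)"
proof -
  have TC: "T (c *\<^sub>C x) = c *\<^sub>C T x" for c x
    using T by (simp add: bounded_clinear_def)
  have "\<exists>a. \<forall>x. T x \<bullet> y = x \<bullet> a" for y
  proof -
    have "bounded_linear (\<lambda>x. T x \<bullet> y)"
      using T by (auto simp: bounded_clinear_def intro: bounded_linear_compose[OF bounded_linear_inner_left])
    then show ?thesis by (rule riesz_representation)
  qed
  then obtain S where S: "\<And>x y. T x \<bullet> y = x \<bullet> S y" by metis
  have "cinner (T x) y = cinner x (S y)" for x y
    by (rule complex_eqI)
      (simp_all add: Im_cinner S flip: inner_eq_Re_cinner TC)
  then have "cadjoint T = S"
    by (rule cadjoint_unique)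
  then show ?thesis using \<open>cinner (T x) y = cinner x (S y)\<close> by simp
qed

lemma inner_cadjoint: "bounded_clinear T \<Longrightarrow> T x \<bullet> y = x \<bullet> cadjoint T y"
  by (simp add: inner_eq_Re_cinner cinner_cadjoint[of T])

lemma cadjoint_add:
  "bounded_clinear T \<Longrightarrow> cadjoint T (x + y) = cadjoint T x + cadjoint T y"
  by (rule cinner_right_eqI) (simp add: cinner_add_right flip: cinner_cadjoint)

lemma cadjoint_scaleC:
  "bounded_clinear T \<Longrightarrow> cadjoint T (c *\<^sub>C x) = c *\<^sub>C cadjoint T x"
  by (rule cinner_right_eqI) (simp add: cinner_scaleC_right flip: cinner_cadjoint)

text \<open>Polarisation: the quadratic form is real at \<open>x + y\<close>, which settles the
  imaginary parts, and at \<open>x + \<i> *\<^sub>C y\<close>, which settles the real parts.\<close>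

lemma positive_operator_selfadjoint:
  assumes "positive_operator T"
  shows "cinner (T x) y = cinner x (T y)"
proof -
  have T: "bounded_linear T" "\<And>c x. T (c *\<^sub>C x) = c *\<^sub>C T x" "\<And>x. cinner (T x) x \<in> \<real>"
    using assms by (auto simp: positive_operator_def bounded_clinear_def)
  have im: "Im (cinner (T z) z) = 0" for z
    using T(3) complex_is_Real_iff by blast
  have add: "T (u + v) = T u + T v" for u v
    using T(1) by (simp add: linear_simps)
  have "Im (cinner (T x) y) + Im (cinner (T y) x) = 0"
    using im[of "x + y"] im[of x] im[of y] by (simp add: add cinner_add_left cinner_add_right)
  moreover have "Re (cinner (T x) y) = Re (cinner (T y) x)"
    using im[of "x + \<i> *\<^sub>C y"] im[of x] im[of y]
    by (simp add: add T(2) cinner_add_left cinner_add_right cinner_scaleC_left cinner_scaleC_right)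
  ultimately have "cinner (T x) y = cnj (cinner (T y) x)"
    by (intro complex_eqI) auto
  then show ?thesis by (simp flip: cinner_commute)
qed

section \<open>Linear relations and kernels\<close>

lemma linear_relationI:
  assumes "0 \<in> R" and "\<And>u v. u \<in> R \<Longrightarrow> v \<in> R \<Longrightarrow> u + v \<in> R"
    and "\<And>c x y. (x, y) \<in> R \<Longrightarrow> (c *\<^sub>C x, c *\<^sub>C y) \<in> R"
  shows "linear_relation R"
proof -
  have "r *\<^sub>R u \<in> R" if "u \<in> R" for r u
    using assms(3)[of "fst u" "snd u" "of_real r"] that
    by (simp add: scaleC_of_real scaleR_prod_def)
  then show ?thesis
    using assms by (auto simp: linear_relation_def subspace_def)
qed

lemma scaleC_zero_right [simp]: "c *\<^sub>C (0::'a::complex_inner_space) = 0"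
  using scaleC_add_right[of c "0::'a" 0] by simp

text \<open>The orthogonal complement of \<open>w\<close> is closed and contains
  \<open>range S\<close>, as \<open>S\<close> can be moved onto \<open>w\<close>.\<close>

lemma kernel_orthogonal_closure_range:
  fixes S :: "'a::real_inner \<Rightarrow> 'a"
  assumes selfadjoint: "\<And>x y. S x \<bullet> y = x \<bullet> S y" and "S w = 0" and "v \<in> closure (range S)"
  shows "w \<bullet> v = 0"
proof -
  have "closed {v. w \<bullet> v = 0}"
    by (intro closed_Collect_eq continuous_intros)
  moreover have "range S \<subseteq> {v. w \<bullet> v = 0}"
    using selfadjoint[of w] \<open>S w = 0\<close> by auto
  ultimately show ?thesis
    using closure_minimal[of "range S"] \<open>v \<in> closure (range S)\<close> by blast
qed

theorem proposition5p3:
  fixes A B \<Gamma> C\<^sub>A C\<^sub>B :: "'a::complex_hilbert_space \<Rightarrow> 'a"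
    and M N :: "'a set"
    and T :: "('a \<times> 'a) set"
  assumes separable: "\<exists>D::'a set. countable D \<and> closure D = UNIV"
    and A: "bounded_clinear A" and B: "bounded_clinear B"
    and M: "M = range A" and N: "N = range B"
    and \<Gamma>: "is_operator_sqrt \<Gamma> (\<lambda>x. A (cadjoint A x) + B (cadjoint B x))"
    and C\<^sub>A: "contraction C\<^sub>A" "A = \<Gamma> \<circ> C\<^sub>A" "range C\<^sub>A \<subseteq> closure (range \<Gamma>)"
    and C\<^sub>B: "contraction C\<^sub>B" "B = \<Gamma> \<circ> C\<^sub>B" "range C\<^sub>B \<subseteq> closure (range \<Gamma>)"
    and T: "T = op_graph \<Gamma> \<odot> op_graph C\<^sub>A \<odot> op_graph (cadjoint C\<^sub>A) \<odot> (op_graph \<Gamma>)\<inverse>"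
  shows "is_direct_sum (mv_projection M N) T ({0} \<times> (M \<inter> N)) \<and>
    is_operator_part T (mv_projection M N)"
proof -
  let ?P = "mv_projection M N"
  let ?Z = "{0} \<times> (M \<inter> N)"
  have bC: "bounded_clinear C\<^sub>A" "bounded_clinear C\<^sub>B"
    using C\<^sub>A C\<^sub>B by (auto simp: contraction_def)
  have \<Gamma>_pos: "positive_operator \<Gamma>" and \<Gamma>_sq: "\<And>x. \<Gamma> (\<Gamma> x) = A (cadjoint A x) + B (cadjoint B x)"
    using \<Gamma> by (auto simp: is_operator_sqrt_def fun_eq_iff)
  have sa: "cinner (\<Gamma> x) y = cinner x (\<Gamma> y)" for x y
    using \<Gamma>_pos by (rule positive_operator_selfadjoint)
  have sai: "\<Gamma> x \<bullet> y = x \<bullet> \<Gamma> y" for x y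
    by (simp add: inner_eq_Re_cinner sa)
  have \<Gamma>_clin: "bounded_clinear \<Gamma>" using \<Gamma>_pos by (simp add: positive_operator_def)
  then have \<Gamma>_lin: "bounded_linear \<Gamma>" by (simp add: bounded_clinear_def)
  have A_lin: "bounded_linear A" and B_lin: "bounded_linear B"
    using A B by (auto simp: bounded_clinear_def)
  have \<Gamma>_0: "\<Gamma> 0 = 0" and \<Gamma>_add: "\<Gamma> (x + y) = \<Gamma> x + \<Gamma> y"
    and \<Gamma>_diff: "\<Gamma> (x - y) = \<Gamma> x - \<Gamma> y" for x y
    using \<Gamma>_lin by (simp_all add: linear_simps)
  have A_eq: "\<Gamma> (C\<^sub>A x) = A x" and B_eq: "\<Gamma> (C\<^sub>B x) = B x" for x
    using C\<^sub>A C\<^sub>B by simp_all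
  have adj: "cadjoint A = cadjoint C\<^sub>A \<circ> \<Gamma>" "cadjoint B = cadjoint C\<^sub>B \<circ> \<Gamma>"
    by (intro cadjoint_unique; simp add: C\<^sub>A(2) C\<^sub>B(2) sa cinner_cadjoint[OF bC(1)] cinner_cadjoint[OF bC(2)])+

  define Q where "Q x = C\<^sub>A (cadjoint C\<^sub>A x) + C\<^sub>B (cadjoint C\<^sub>B x)" for x
  \<comment> \<open>The right-hand side is symmetric in \<open>x\<close> and \<open>y\<close>, hence
    \<open>Q\<close> is self-adjoint.\<close>
  have Q_form: "Q x \<bullet> y = cadjoint C\<^sub>A x \<bullet> cadjoint C\<^sub>A y + cadjoint C\<^sub>B x \<bullet> cadjoint C\<^sub>B y" for x y
    by (simp add: Q_def inner_add_left inner_cadjoint[OF bC(1)] inner_cadjoint[OF bC(2)])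
  then have Q_sym: "Q x \<bullet> y = x \<bullet> Q y" for x y
    using Q_form[of x y] Q_form[of y x] by (simp add: inner_commute)
  have Q_\<Gamma>: "Q (\<Gamma> z) = \<Gamma> z" for z
  proof -
    define w where "w = Q (\<Gamma> z) - \<Gamma> z"
    have "\<Gamma> (Q (\<Gamma> z)) = \<Gamma> (\<Gamma> z)"
      by (simp add: \<Gamma>_sq Q_def \<Gamma>_add A_eq B_eq adj)
    then have "\<Gamma> w = 0" by (simp add: w_def \<Gamma>_diff)
    then have orth: "w \<bullet> v = 0" if "v \<in> closure (range \<Gamma>)" for v
      using sai that by (intro kernel_orthogonal_closure_range[of \<Gamma>])
    \<comment> \<open>Only the second factor is expanded: its three terms all lie in the closure of
      \<open>range \<Gamma>\<close>, to which the first factor is orthogonal.\<close>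
    have "w \<bullet> w = w \<bullet> C\<^sub>A (cadjoint C\<^sub>A (\<Gamma> z)) + w \<bullet> C\<^sub>B (cadjoint C\<^sub>B (\<Gamma> z)) - w \<bullet> \<Gamma> z"
      by (subst (2) w_def) (simp add: Q_def inner_diff_right inner_add_right)
    also have "\<dots> = 0"
      using C\<^sub>A(3) C\<^sub>B(3) closure_subset[of "range \<Gamma>"] by (simp add: orth range_subsetD subsetD)
    finally have "w = 0" by simp
    then show ?thesis by (simp add: w_def)
  qed
  have decomp: "\<Gamma> x = A (cadjoint C\<^sub>A x) + B (cadjoint C\<^sub>B x)" for x
  proof -
    have "y \<bullet> \<Gamma> (Q x) = y \<bullet> \<Gamma> x" for y
      by (metis sai Q_sym Q_\<Gamma>)
    then have "\<Gamma> (Q x) = \<Gamma> x" using vector_eq_ldot by blast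
    then show ?thesis by (simp add: Q_def \<Gamma>_add A_eq B_eq)
  qed
  \<comment> \<open>The squared norm of \<open>cadjoint C\<^sub>A x\<close> is the inner product of
    \<open>x\<close> with a vector in \<open>range C\<^sub>A\<close>. This makes \<open>T\<close>
    single-valued.\<close>
  have kernel: "cadjoint C\<^sub>A x = 0" if "\<Gamma> x = 0" for x
  proof -
    have "x \<bullet> C\<^sub>A (cadjoint C\<^sub>A x) = 0"
      using C\<^sub>A(3) by (intro kernel_orthogonal_closure_range[of \<Gamma>] sai that) auto
    then show ?thesis
      by (simp add: inner_commute[of x] inner_cadjoint[OF bC(1)])
  qed

  \<comment> \<open>Parametrising by a preimage \<open>x\<close> under \<open>\<Gamma>\<close> turns
    the inverse relation into a choice of \<open>x\<close>.\<close>
  have T_eq: "T = {(\<Gamma> x, A (cadjoint C\<^sub>A x)) | x. True}"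
    unfolding T rel_prod_def op_graph_def by (auto simp: relcomp_unfold A_eq) (metis A_eq)
  have T_lin: "linear_relation T"
  proof (rule linear_relationI)
    show "0 \<in> T"
      using \<Gamma>_0 kernel[OF \<Gamma>_0] linear_simps(3)[OF A_lin]
      by (force simp: T_eq zero_prod_def)
    show "u + v \<in> T" if "u \<in> T" "v \<in> T" for u v
      using that unfolding T_eq
      by clarsimp (metis \<Gamma>_add cadjoint_add[OF bC(1)] linear_simps(1)[OF A_lin])
    show "(c *\<^sub>C x, c *\<^sub>C y) \<in> T" if "(x, y) \<in> T" for c x y
      using that \<Gamma>_clin A cadjoint_scaleC[OF bC(1)] unfolding T_eq bounded_clinear_def
      by clarsimp metis
  qed
  have T_mul: "y = 0" if "(0, y) \<in> T" for y
    using that kernel linear_simps(3)[OF A_lin] by (auto simp: T_eq)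
  \<comment> \<open>The summand in \<open>N\<close> is determined as \<open>x - y\<close>, so no
    existential is left.\<close>
  have P_iff: "(x, y) \<in> ?P \<longleftrightarrow> y \<in> M \<and> x - y \<in> N" for x y
    unfolding mv_projection_def by force
  have subspaces: "subspace M" "subspace N"
    using A_lin B_lin by (auto simp: M N bounded_linear.linear intro: linear_subspace_image)
  have T_P: "T \<subseteq> ?P"
    using decomp unfolding T_eq mv_projection_def M N by blast
  have dom: "Domain T = Domain ?P"
  proof
    show "Domain ?P \<subseteq> Domain T"
    proof
      fix x assume "x \<in> Domain ?P"
      then obtain a b where "x = A a + B b"
        by (auto simp: mv_projection_def M N)
      \<comment> \<open>The factorisations of \<open>A\<close> and \<open>B\<close> put
        \<open>M + N\<close> inside \<open>range \<Gamma>\<close>.\<close>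
      then have "x = \<Gamma> (C\<^sub>A a + C\<^sub>B b)" by (simp add: \<Gamma>_add A_eq B_eq)
      then show "x \<in> Domain T" by (auto simp: T_eq)
    qed
  qed (use T_P in auto)
  have "?P = T + ?Z"
  proof (intro set_eqI iffI)
    fix p assume p: "p \<in> ?P"
    obtain x y where xy: "p = (x, y)" by force
    then obtain t where t: "(x, t) \<in> T" using p dom by blast
    then have "(x, t) \<in> ?P" using T_P by blast
    \<comment> \<open>Two values of the projection at the same \<open>x\<close> differ by an element
      of \<open>M \<inter> N\<close>: the second difference is again \<open>y - t\<close>.\<close>
    then have "y - t \<in> M" "(x - t) - (x - y) \<in> N"
      using p xy subspaces by (metis P_iff subspace_diff)+
    then have "(0, y - t) \<in> ?Z" by simp
    moreover have "p = (x, t) + (0, y - t)" using xy by simp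
    ultimately show "p \<in> T + ?Z" using t by (metis set_plus_intro)
  next
    fix p assume "p \<in> T + ?Z"
    then obtain x t z where "p = (x, t) + (0, z)" and t: "(x, t) \<in> T" and z: "z \<in> M" "z \<in> N"
      by (auto elim!: set_plus_elim)
    moreover have "t \<in> M" "x - t \<in> N" using t T_P P_iff by blast+
    ultimately show "p \<in> ?P"
      using subspaces subspace_add[of M t z] subspace_diff[of N "x - t" z]
      by (simp add: P_iff algebra_simps)
  qed
  moreover have "linear_relation ?Z"
  proof (rule linear_relationI)
    show "(c *\<^sub>C x, c *\<^sub>C y) \<in> ?Z" if "(x, y) \<in> ?Z" for c x y
      using that A B by (auto simp: M N bounded_clinear_def) (metis rangeI)+
  qed (use subspaces in \<open>auto simp: zero_prod_def subspace_0 subspace_add\<close>)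
  \<comment> \<open>One half of \<open>T \<inter> ?Z = {0}\<close>; the other is
    \<open>T_mul\<close>.\<close>
  moreover have "0 \<in> T" "0 \<in> ?Z"
    using T_lin subspaces subspace_0[of T]
    by (auto simp: linear_relation_def subspace_0 zero_prod_def)
  ultimately show ?thesis
    using T_lin T_mul T_P dom
    by (auto simp: is_direct_sum_def is_operator_part_def is_operator_def rel_mul_def zero_prod_def)
qed

end
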